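(* Let $d_1,\dots,d_N\in\mathbb{R}^p$, let $B\ge 0$ be an integer budget, let $\alpha,\delta\in(0,1)$, let $U$ be a random vector in $\mathbb{R}^p$, and let $u_1,\dots,u_m$ ($m\ge 1$) be i.i.d. samples with the distribution of $U$. Put $$\eta:=\sqrt{\frac{1}{2m}\log\Big(\frac{2\sum_{k=0}^{B}\binom{N}{k}}{\delta}\Big)}$$ and assume $\eta\le\alpha$. For each $S\subseteq[N]$ let $\widehat r(S):=\widehat Q_{1-\alpha+\eta}(Z_S)$. Then with probability at least $1-\delta$ over the sample $u_1,\dots,u_m$, simultaneously for every $S\subseteq[N]$ with $|S|\le B$, $$\mathbb{P}\big(Z_S(U)>\widehat r(S)\big)\le\alpha,$$ where this probability is over a fresh draw $U$ independent of the sample, with $\widehat r(S)$ held fixed.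
   Context: $[N]=\{1,\dots,N\}$, $d_0:=0\in\mathbb{R}^p$, $S_0:=S\cup\{0\}$. The directional score is $Z_S(u):=\max_{i\in S_0}\langle d_i,u\rangle$. $\widehat Q_\beta(Z_S)$ denotes the empirical $\beta$-quantile of the scores $Z_S(u_1),\dots,Z_S(u_m)$, i.e. $\inf\{z\in\mathbb{R}:\frac1m\#\{j:Z_S(u_j)\le z\}\ge\beta\}$. *)

theory Defs
  imports "HOL-Probability.Probability"
begin

text \<open>
  The directional score \<open>Z\<^sub>S(u) = max\<^bsub>i \<in> S \<union> {0}\<^esub> \<langle>d\<^sub>i, u\<rangle>\<close>. The convention \<open>d\<^sub>0 = 0\<close> is
  enforced by the update, so the value of the argument \<open>d\<close> at \<open>0\<close> is irrelevant.
  \<open>Max\<close> is meaningful for finite \<open>S\<close> only.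
\<close>
definition dir_score :: "(nat \<Rightarrow> real ^ 'p) \<Rightarrow> nat set \<Rightarrow> real ^ 'p \<Rightarrow> real" where
  "dir_score d S u = Max ((\<lambda>i. inner ((d(0 := 0)) i) u) ` (S \<union> {0}))"

text \<open>
  The set whose infimum is taken is nonempty and bounded below for \<open>m \<ge> 1\<close> and \<open>0 < \<beta> \<le> 1\<close>;
  outside this range \<open>Inf\<close> on the reals carries no meaning.
\<close>
definition emp_quantile :: "real \<Rightarrow> nat \<Rightarrow> (nat \<Rightarrow> real) \<Rightarrow> real" where
  "emp_quantile \<beta> m x = Inf {z. 1 / real m * real (card {j \<in> {1..m}. x j \<le> z}) \<ge> \<beta>}"

end

theory Submission imports Defs
begin

text \<open>
  Fix \<open>S\<close>, let \<open>F\<close> be the distribution function of the score and let \<open>A = {z. F z < 1 - \<alpha>}\<close>, a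
  down-closed set that carries probability at most \<open>1 - \<alpha>\<close> under the score distribution. If the
  guarantee fails for \<open>S\<close>, the empirical quantile lies in \<open>A\<close>, and hence so does at least a
  fraction \<open>1 - \<alpha> + \<eta>\<close> of the sampled scores. By Hoeffding's inequality for the indicators of
  \<open>A\<close> this has probability at most \<open>exp (-2 m \<eta>\<^sup>2)\<close>, which is \<open>\<delta>\<close> divided by twice the
  number of admissible \<open>S\<close>; a union bound finishes the proof. Only a single fixed set \<open>A\<close> is needed
  per \<open>S\<close>, so no uniform (Dvoretzky--Kiefer--Wolfowitz) bound enters.
\<close>

section \<open>Empirical quantiles\<close>

text \<open>The empirical distribution function is a step function whose jumps are attained from the
  right, so the infimum defining the quantile is a minimum. Taking \<open>z\<close> to be the
  quantile itself bounds the sample fraction below it; arbitrary \<open>z\<close> gives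
  measurability.\<close>

lemma emp_quantile_le_iff:
  assumes m: "m \<ge> 1" and \<beta>: "0 < \<beta>" "\<beta> \<le> 1"
  shows "emp_quantile \<beta> m x \<le> z \<longleftrightarrow> \<beta> \<le> 1 / real m * real (card {j \<in> {1..m}. x j \<le> z})"
proof -
  define f where "f z = 1 / real m * real (card {j \<in> {1..m}. x j \<le> z})" for z
  define T where "T = {z. \<beta> \<le> f z}"
  have Q: "emp_quantile \<beta> m x = Inf T"
    unfolding emp_quantile_def T_def f_def ..
  have f_mono: "f y \<le> f z" if "y \<le> z" for y z
    unfolding f_def using that by (intro mult_left_mono) (auto intro!: card_mono)
  have f_one: "f z = 1" if "\<And>j. j \<in> {1..m} \<Longrightarrow> x j \<le> z" for z
  proof -
    have "{j \<in> {1..m}. x j \<le> z} = {1..m}" using that by auto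
    thus ?thesis using m by (simp add: f_def)
  qed
  have ne: "T \<noteq> {}"
  proof -
    have "f (Max (x ` {1..m})) = 1" by (intro f_one) auto
    hence "Max (x ` {1..m}) \<in> T" using \<beta> by (simp add: T_def)
    thus ?thesis by blast
  qed
  \<comment> \<open>Since \<open>0 < \<beta>\<close>, a point of \<open>T\<close> has some sample
    value at or below it, so the smallest sample value is a lower bound.\<close>
  have bdd: "bdd_below T"
  proof (rule bdd_belowI)
    fix t assume "t \<in> T"
    hence "0 < f t" using \<beta> by (simp add: T_def)
    hence "card {j \<in> {1..m}. x j \<le> t} \<noteq> 0" unfolding f_def by (metis less_irrefl mult_zero_right of_nat_0)
    hence "{j \<in> {1..m}. x j \<le> t} \<noteq> {}" by (metis card.empty)
    then obtain j where j: "j \<in> {1..m}" "x j \<le> t" by auto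
    have "Min (x ` {1..m}) \<le> x j" using j by (intro Min_le) auto
    with j show "Min (x ` {1..m}) \<le> t" by (meson order_trans)
  qed
  have attained: "Inf T \<in> T"
  proof (rule ccontr)
    assume "Inf T \<notin> T"
    hence lt: "f (Inf T) < \<beta>" by (simp add: T_def)
    \<comment> \<open>The sample values strictly beyond \<open>Inf T\<close>. Up to the first of
      them \<open>f\<close> keeps its value at \<open>Inf T\<close>, which is below
      \<open>\<beta>\<close>; so every point of \<open>T\<close> has passed one, and
      \<open>Min W\<close> is a lower bound of \<open>T\<close> larger than its infimum.\<close>
    define W where "W = {w \<in> x ` {1..m}. Inf T < w}"
    have fin: "finite W" by (simp add: W_def)
    have inW: "\<exists>w\<in>W. w \<le> t" if "t \<in> T" for t
    proof (rule ccontr)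
      assume none: "\<not> (\<exists>w\<in>W. w \<le> t)"
      have "{j \<in> {1..m}. x j \<le> t} \<subseteq> {j \<in> {1..m}. x j \<le> Inf T}"
        using none by (force simp: W_def)
      hence "card {j \<in> {1..m}. x j \<le> t} \<le> card {j \<in> {1..m}. x j \<le> Inf T}"
        by (intro card_mono) auto
      hence "f t \<le> f (Inf T)"
        unfolding f_def by (intro mult_left_mono of_nat_mono) auto
      with lt that show False by (simp add: T_def)
    qed
    have W_ne: "W \<noteq> {}" using ne inW by blast
    have "Min W \<le> t" if "t \<in> T" for t
      using inW[OF that] fin by (meson Min_le order_trans)
    hence "Min W \<le> Inf T" using ne by (intro cInf_greatest)
    moreover have "Inf T < Min W"
      using Min_in[OF fin W_ne] by (simp add: W_def)
    ultimately show False by simp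
  qed
  have "Inf T \<le> z \<longleftrightarrow> \<beta> \<le> f z"
  proof
    assume "Inf T \<le> z"
    from f_mono[OF this] attained show "\<beta> \<le> f z" by (simp add: T_def)
  next
    assume "\<beta> \<le> f z"
    thus "Inf T \<le> z" using bdd by (intro cInf_lower) (simp_all add: T_def)
  qed
  thus ?thesis by (simp add: Q f_def)
qed

text \<open>Turns sample counts into sums, the shape in which measurability and Hoeffding's
  inequality apply.\<close>

lemma real_card_filter_eq_sum_indicator:
  assumes "finite I"
  shows "real (card {j \<in> I. x j \<in> A}) = (\<Sum>j\<in>I. indicator A (x j))"
  using assms by (simp add: indicator_def sum.If_cases Int_def)

lemma emp_quantile_measurable:
  assumes "m \<ge> 1" "0 < \<beta>" "\<beta> \<le> 1"
    and [measurable]: "\<And>j. j \<in> {1..m} \<Longrightarrow> X j \<in> borel_measurable M"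
  shows "(\<lambda>\<omega>. emp_quantile \<beta> m (\<lambda>j. X j \<omega>)) \<in> borel_measurable M"
proof (rule borel_measurableI_le)
  fix z :: real
  have "real (card {j \<in> {1..m}. X j \<omega> \<le> z}) = (\<Sum>j\<in>{1..m}. indicator {..z} (X j \<omega>))" for \<omega>
    using real_card_filter_eq_sum_indicator[of "{1..m}" "\<lambda>j. X j \<omega>" "{..z}"] by simp
  moreover have "{\<omega> \<in> space M. \<beta> \<le> 1 / real m * (\<Sum>j\<in>{1..m}. indicator {..z} (X j \<omega>))} \<in> sets M"
    by measurable
  ultimately show "{\<omega> \<in> space M. emp_quantile \<beta> m (\<lambda>j. X j \<omega>) \<le> z} \<in> sets M"
    using assms(1-3) by (simp add: emp_quantile_le_iff)
qed

section \<open>Distribution functions and the bound for a single score\<close>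

lemma (in real_distribution) borel_measurable_cdf: "cdf M \<in> borel_measurable borel"
  by (intro borel_measurable_mono monoI cdf_nondecreasing)

text \<open>Inner regularity reduces the claim to compact subsets. A nonempty compact subset has a
  largest element \<open>s\<close>, lies in \<open>{..s}\<close>, and so has probability at most
  \<open>cdf M s < c\<close>. This avoids locating the endpoint of the half-line and taking left
  limits there.\<close>

lemma (in real_distribution) prob_cdf_less_le:
  assumes "0 \<le> c"
  shows "prob {z. cdf M z < c} \<le> c"
proof -
  let ?A = "{z. cdf M z < c}"
  have A: "?A \<in> sets borel"
    using borel_measurable_cdf by measurable
  have "emeasure M ?A = (SUP K \<in> {K. K \<subseteq> ?A \<and> compact K}. emeasure M K)"
    by (rule inner_regular[OF events_eq_borel _ A]) simp
  also have "\<dots> \<le> ennreal c"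
  proof (rule SUP_least)
    fix K assume "K \<in> {K. K \<subseteq> ?A \<and> compact K}"
    hence K: "K \<subseteq> ?A" "compact K" by auto
    show "emeasure M K \<le> ennreal c"
    proof (cases "K = {}")
      case False
      obtain s where s: "s \<in> K" "\<And>t. t \<in> K \<Longrightarrow> t \<le> s"
        using compact_attains_sup[OF K(2) False] by metis
      have "prob K \<le> cdf M s"
        unfolding cdf_def using s by (intro finite_measure_mono) auto
      also have "\<dots> \<le> c" using s(1) K(1) by (simp add: subset_iff less_imp_le)
      finally show ?thesis by (simp add: emeasure_eq_measure ennreal_leI)
    qed simp
  qed
  finally show ?thesis
    using assms by (simp add: emeasure_eq_measure)
qed

text \<open>Applied below with \<open>c = 1 - \<alpha>\<close> and
  \<open>\<beta> = 1 - \<alpha> + \<eta>\<close>: the gap \<open>\<beta> - c\<close> is the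
  deviation in Hoeffding's inequality.\<close>

lemma (in prob_space) prob_cdf_emp_quantile_less:
  assumes m: "m \<ge> 1" and c: "0 \<le> c" "c \<le> \<beta>" and \<beta>: "0 < \<beta>" "\<beta> \<le> 1"
    and indep: "indep_vars (\<lambda>_. borel) X {1..m}"
    and D: "\<And>j. j \<in> {1..m} \<Longrightarrow> distr M borel (X j) = D"
  shows "prob {\<omega> \<in> space M. cdf D (emp_quantile \<beta> m (\<lambda>j. X j \<omega>)) < c}
           \<le> exp (- 2 * real m * (\<beta> - c)\<^sup>2)"
proof -
  have X [measurable]: "X j \<in> borel_measurable M" if "j \<in> {1..m}" for j
    using indep that by (auto simp: indep_vars_def)
  \<comment> \<open>Index 1 serves as representative of the common law.\<close>
  have one: "1 \<in> {1..m}" using m by simp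
  interpret D: real_distribution D
    using real_distribution_distr[OF X[OF one]] D[OF one] by simp
  define A where "A = {z. cdf D z < c}"
  have A [measurable]: "A \<in> sets borel"
    unfolding A_def using D.borel_measurable_cdf by measurable
  define Y where "Y j \<omega> = (indicator A (X j \<omega>) :: real)" for j \<omega>
  have Y [measurable]: "Y j \<in> borel_measurable M" if "j \<in> {1..m}" for j
    unfolding Y_def using X[OF that] by measurable
  have distr_Y: "distr M borel (Y j) = distr D borel (indicator A)" if "j \<in> {1..m}" for j
  proof -
    have "distr D borel (indicator A) = distr (distr M borel (X j)) borel (indicator A :: real \<Rightarrow> real)"
      using D[OF that] by simp
    also have "\<dots> = distr M borel (Y j)"
      by (subst distr_distr) (use X[OF that] in \<open>auto simp: Y_def[abs_def] comp_def\<close>)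
    finally show ?thesis ..
  qed
  have indep_Y: "indep_vars (\<lambda>_. borel) Y {1..m}"
    unfolding Y_def using indep_vars_compose2[OF indep, of "\<lambda>_. indicator A" "\<lambda>_. borel"] A by auto
  interpret H: Hoeffding_ineq_iid M "{1..m}" Y "Y 1" 0 1 "expectation (Y 1)"
    by unfold_locales (use indep_Y distr_Y one Y in \<open>auto simp: Y_def\<close>)
  have "expectation (Y 1) = prob (X 1 -` A \<inter> space M)"
  proof -
    have "expectation (Y 1) = expectation (indicator (X 1 -` A \<inter> space M))"
      by (intro Bochner_Integration.integral_cong) (auto simp: Y_def indicator_def)
    thus ?thesis by (simp add: Int_absorb2)
  qed
  also have "\<dots> = measure D A"
    using X[OF one] by (subst D[OF one, symmetric]) (simp add: measure_distr)
  also have "\<dots> \<le> c"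
    unfolding A_def by (rule D.prob_cdf_less_le) fact
  finally have mean: "expectation (Y 1) \<le> c" .
  have "prob {\<omega> \<in> space M. cdf D (emp_quantile \<beta> m (\<lambda>j. X j \<omega>)) < c}
      \<le> prob {\<omega> \<in> space M. (\<Sum>j\<in>{1..m}. Y j \<omega>) / real (card {1..m}) \<ge> expectation (Y 1) + (\<beta> - c)}"
  proof (rule finite_measure_mono)
    show "{\<omega> \<in> space M. (\<Sum>j\<in>{1..m}. Y j \<omega>) / real (card {1..m}) \<ge> expectation (Y 1) + (\<beta> - c)} \<in> events"
      by measurable
  next
    show "{\<omega> \<in> space M. cdf D (emp_quantile \<beta> m (\<lambda>j. X j \<omega>)) < c}
      \<subseteq> {\<omega> \<in> space M. (\<Sum>j\<in>{1..m}. Y j \<omega>) / real (card {1..m}) \<ge> expectation (Y 1) + (\<beta> - c)}"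
    proof safe
      fix \<omega> assume less: "cdf D (emp_quantile \<beta> m (\<lambda>j. X j \<omega>)) < c"
      let ?q = "emp_quantile \<beta> m (\<lambda>j. X j \<omega>)"
      \<comment> \<open>Monotonicity of the distribution function puts the whole ray below the
        quantile into \<open>A\<close>, so every sample value counted by the quantile is counted by
        \<open>A\<close>.\<close>
      have down: "{..?q} \<subseteq> A"
        unfolding A_def using less D.cdf_nondecreasing by (auto intro: le_less_trans)
      have "\<beta> \<le> 1 / real m * real (card {j \<in> {1..m}. X j \<omega> \<le> ?q})"
        using emp_quantile_le_iff[OF m \<beta>, of "\<lambda>j. X j \<omega>" ?q] by simp
      also have "\<dots> \<le> 1 / real m * real (card {j \<in> {1..m}. X j \<omega> \<in> A})"
        using down by (intro mult_left_mono) (auto intro!: card_mono)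
      also have "\<dots> = (\<Sum>j\<in>{1..m}. Y j \<omega>) / real (card {1..m})"
        by (subst real_card_filter_eq_sum_indicator) (simp_all add: Y_def)
      \<comment> \<open>The true mean is at most \<open>c\<close>, so a sample mean of at least
        \<open>\<beta>\<close> exceeds it by at least \<open>\<beta> - c\<close>.\<close>
      finally show "expectation (Y 1) + (\<beta> - c) \<le> (\<Sum>j\<in>{1..m}. Y j \<omega>) / real (card {1..m})"
        using mean by simp
    qed
  qed
  also have "\<dots> \<le> exp (- 2 * real (card {1..m}) * (\<beta> - c)\<^sup>2 / (1 - 0)\<^sup>2)"
    using c m by (intro H.Hoeffding_ineq_ge') auto
  finally show ?thesis by simp
qed

section \<open>The scores, the admissible sets and the union bound\<close>

lemma borel_measurable_dir_score:
  assumes "finite S"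
  shows "dir_score d S \<in> borel_measurable borel"
  unfolding dir_score_def using assms by (intro borel_measurable_Max) auto

lemma card_bounded_subsets:
  assumes "finite A"
  shows "card {S. S \<subseteq> A \<and> card S \<le> B} = (\<Sum>k=0..B. card A choose k)"
proof -
  have "{S. S \<subseteq> A \<and> card S \<le> B} = (\<Union>k\<in>{0..B}. {S. S \<subseteq> A \<and> card S = k})"
    by auto
  also have "card \<dots> = (\<Sum>k=0..B. card {S. S \<subseteq> A \<and> card S = k})"
    using assms by (intro card_UN_disjoint) auto
  also have "\<dots> = (\<Sum>k=0..B. card A choose k)"
    using n_subsets[OF assms] by simp
  finally show ?thesis .
qed

theorem theorem3p3:
  fixes N B m :: nat
    and d :: "nat \<Rightarrow> real ^ 'p"
    and \<alpha> \<delta> \<eta> :: real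
    and M :: "'a measure" and M' :: "'b measure"
    and u :: "nat \<Rightarrow> 'a \<Rightarrow> real ^ 'p" and U :: "'b \<Rightarrow> real ^ 'p"
    and r :: "nat set \<Rightarrow> 'a \<Rightarrow> real"
  assumes "0 < \<alpha>" "\<alpha> < 1" and "0 < \<delta>" "\<delta> < 1" and "m \<ge> 1"
    and "prob_space M'" and "U \<in> borel_measurable M'"
    and "prob_space M"
    and "prob_space.indep_vars M (\<lambda>_. borel) u {1..m}"
    and "\<And>j. j \<in> {1..m} \<Longrightarrow> distr M borel (u j) = distr M' borel U"
    and "\<eta> = sqrt (1 / (2 * real m) * ln (2 * (\<Sum>k=0..B. real (N choose k)) / \<delta>))"
    and "\<eta> \<le> \<alpha>"
    and "\<And>S \<omega>. S \<subseteq> {1..N} \<Longrightarrow>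
           r S \<omega> = emp_quantile (1 - \<alpha> + \<eta>) m (\<lambda>j. dir_score d S (u j \<omega>))"
  shows "measure M {\<omega> \<in> space M. \<forall>S. S \<subseteq> {1..N} \<and> card S \<le> B \<longrightarrow>
           measure M' {\<omega>' \<in> space M'. dir_score d S (U \<omega>') > r S \<omega>} \<le> \<alpha>} \<ge> 1 - \<delta>"
proof -
  interpret M: prob_space M by fact
  interpret M': prob_space M' by fact
  define \<beta> where "\<beta> = 1 - \<alpha> + \<eta>"
  define c where "c = (\<Sum>k=0..B. real (N choose k))"
  define \<S> where "\<S> = {S. S \<subseteq> {1..N} \<and> card S \<le> B}"
  have fin_S: "finite \<S>" unfolding \<S>_def by simp
  have card_S: "real (card \<S>) = c"
    unfolding \<S>_def c_def by (simp add: card_bounded_subsets)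
  \<comment> \<open>The empty set is always admissible. Hence \<open>c \<ge> 1\<close>, the
    logarithm is nonnegative, and squaring undoes the square root in \<open>\<eta>\<close>.\<close>
  have "{} \<in> \<S>" by (simp add: \<S>_def)
  hence "card \<S> \<ge> 1" using fin_S by (metis One_nat_def Suc_leI card_gt_0_iff empty_iff)
  hence c1: "c \<ge> 1" using card_S by linarith
  have ln_nonneg: "ln (2 * c / \<delta>) \<ge> 0"
    using c1 assms(3,4) by (intro ln_ge_zero) (simp add: field_simps)
  have \<eta>: "\<eta> = sqrt (1 / (2 * real m) * ln (2 * c / \<delta>))"
    using assms(11) by (simp add: c_def)
  hence \<eta>_nonneg: "\<eta> \<ge> 0" using ln_nonneg by simp
  have "\<eta>\<^sup>2 = 1 / (2 * real m) * ln (2 * c / \<delta>)"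
    unfolding \<eta> using ln_nonneg by (intro real_sqrt_pow2) simp
  hence "- 2 * real m * \<eta>\<^sup>2 = - ln (2 * c / \<delta>)"
    using \<open>m \<ge> 1\<close> by simp
  hence exp_\<eta>: "exp (- 2 * real m * \<eta>\<^sup>2) = \<delta> / (2 * c)"
    using c1 \<open>0 < \<delta>\<close> by (simp add: exp_minus)
  \<comment> \<open>The assumption \<open>\<eta> \<le> \<alpha>\<close> enters here: it keeps the
    quantile level at most 1.\<close>
  have \<beta>: "0 < \<beta>" "\<beta> \<le> 1" "1 - \<alpha> \<le> \<beta>"
    using \<eta>_nonneg assms(1,2,12) by (simp_all add: \<beta>_def)
  define D where "D S = distr M' borel (\<lambda>\<omega>'. dir_score d S (U \<omega>'))" for S
  define X where "X S j \<omega> = dir_score d S (u j \<omega>)" for S j \<omega>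
  define bad where "bad S = {\<omega> \<in> space M. cdf (D S) (emp_quantile \<beta> m (\<lambda>j. X S j \<omega>)) < 1 - \<alpha>}" for S
  \<comment> \<open>An equivalence rather than an implication, so that the good event is exactly the
    complement of the bad ones and inherits their measurability.\<close>
  have bad: "bad S \<in> sets M \<and> M.prob (bad S) \<le> \<delta> / (2 * c) \<and>
      (\<forall>\<omega> \<in> space M. \<omega> \<notin> bad S \<longleftrightarrow>
        measure M' {\<omega>' \<in> space M'. dir_score d S (U \<omega>') > r S \<omega>} \<le> \<alpha>)"
    if S: "S \<in> \<S>" for S
  proof -
    have sub: "S \<subseteq> {1..N}" and finS: "finite S"
      using S by (auto simp: \<S>_def intro: finite_subset)
    note Z [measurable] = borel_measurable_dir_score[OF finS, of d]
    note U [measurable] = \<open>U \<in> borel_measurable M'\<close>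
    have u [measurable]: "u j \<in> borel_measurable M" if "j \<in> {1..m}" for j
      using assms(9) that by (auto simp: M.indep_vars_def)
    interpret D: real_distribution "D S"
      unfolding D_def by (rule M'.real_distribution_distr) measurable
    have indep: "M.indep_vars (\<lambda>_. borel) (X S) {1..m}"
      unfolding X_def using M.indep_vars_compose2[OF assms(9), of "\<lambda>_. dir_score d S" "\<lambda>_. borel"] Z
      by auto
    \<comment> \<open>Sampled and fresh scores share a law, as images of the same law under
      \<open>dir_score d S\<close>.\<close>
    have distr_X: "distr M borel (X S j) = D S" if j: "j \<in> {1..m}" for j
    proof -
      have "distr M borel (X S j) = distr (distr M borel (u j)) borel (dir_score d S)"
        by (subst distr_distr) (use u[OF j] Z in \<open>auto simp: X_def[abs_def] comp_def\<close>)
      also have "\<dots> = distr (distr M' borel U) borel (dir_score d S)"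
        using assms(10)[OF j] by simp
      also have "\<dots> = D S"
        by (subst distr_distr) (use U Z in \<open>auto simp: D_def comp_def\<close>)
      finally show ?thesis .
    qed
    have X [measurable]: "X S j \<in> borel_measurable M" if "j \<in> {1..m}" for j
      unfolding X_def using u[OF that] by measurable
    have q [measurable]: "(\<lambda>\<omega>. emp_quantile \<beta> m (\<lambda>j. X S j \<omega>)) \<in> borel_measurable M"
      using \<open>m \<ge> 1\<close> \<beta> X by (intro emp_quantile_measurable)
    have meas: "bad S \<in> sets M"
      unfolding bad_def using D.borel_measurable_cdf by measurable
    have "M.prob (bad S) \<le> exp (- 2 * real m * (\<beta> - (1 - \<alpha>))\<^sup>2)"
      unfolding bad_def using \<open>m \<ge> 1\<close> \<open>\<alpha> < 1\<close> \<beta> indep distr_X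
      by (intro M.prob_cdf_emp_quantile_less) auto
    also have "\<dots> = \<delta> / (2 * c)"
      using exp_\<eta> by (simp add: \<beta>_def)
    finally have prob: "M.prob (bad S) \<le> \<delta> / (2 * c)" .
    have good: "\<omega> \<notin> bad S \<longleftrightarrow>
        measure M' {\<omega>' \<in> space M'. dir_score d S (U \<omega>') > r S \<omega>} \<le> \<alpha>"
      if \<omega>: "\<omega> \<in> space M" for \<omega>
    proof -
      have "r S \<omega> = emp_quantile \<beta> m (\<lambda>j. X S j \<omega>)"
        using assms(13)[OF sub] by (simp add: \<beta>_def X_def)
      hence bad_iff: "\<omega> \<notin> bad S \<longleftrightarrow> cdf (D S) (r S \<omega>) \<ge> 1 - \<alpha>"
        using \<omega> by (auto simp: bad_def)
      have "cdf (D S) (r S \<omega>) = measure M' {\<omega>' \<in> space M'. dir_score d S (U \<omega>') \<le> r S \<omega>}"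
        unfolding cdf_def D_def
        by (subst measure_distr) (auto intro!: arg_cong[where f = "measure M'"])
      moreover have "{\<omega>' \<in> space M'. dir_score d S (U \<omega>') > r S \<omega>} =
          space M' - {\<omega>' \<in> space M'. dir_score d S (U \<omega>') \<le> r S \<omega>}"
        by auto
      ultimately have "measure M' {\<omega>' \<in> space M'. dir_score d S (U \<omega>') > r S \<omega>} =
          1 - cdf (D S) (r S \<omega>)"
        by (simp add: M'.prob_compl)
      with bad_iff show ?thesis by auto
    qed
    show ?thesis using meas prob good by blast
  qed
  let ?G = "{\<omega> \<in> space M. \<forall>S. S \<subseteq> {1..N} \<and> card S \<le> B \<longrightarrow>
           measure M' {\<omega>' \<in> space M'. dir_score d S (U \<omega>') > r S \<omega>} \<le> \<alpha>}"
  have "?G = space M - (\<Union>S\<in>\<S>. bad S)"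
    using bad by (auto simp: \<S>_def)
  moreover have "(\<Union>S\<in>\<S>. bad S) \<in> sets M"
    using fin_S bad by (intro sets.finite_UN) auto
  ultimately have "M.prob ?G = 1 - M.prob (\<Union>S\<in>\<S>. bad S)"
    by (simp add: M.prob_compl)
  moreover have "M.prob (\<Union>S\<in>\<S>. bad S) \<le> (\<Sum>S\<in>\<S>. M.prob (bad S))"
    using fin_S bad by (intro M.finite_measure_subadditive_finite) auto
  moreover have "(\<Sum>S\<in>\<S>. M.prob (bad S)) \<le> real (card \<S>) * (\<delta> / (2 * c))"
    using bad by (intro sum_bounded_above) auto
  \<comment> \<open>As \<open>card \<S>\<close> equals \<open>c\<close>, the left side is
    \<open>\<delta> / 2\<close>.\<close>
  moreover have "real (card \<S>) * (\<delta> / (2 * c)) \<le> \<delta>"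
    using card_S c1 \<open>0 < \<delta>\<close> by simp
  ultimately show ?thesis by linarith
qed

end
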